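(* Let $M$ be a smooth manifold, $n\ge 2$, and let $P\in\Gamma(\bigwedge^nTM)$ be an $n$-vector with induced anchor $\rho=P^\sharp$. Then pointwise $\operatorname{Rad}(\rho)=\operatorname{Ann}(P)$; that is, $\operatorname{Rad}(\rho)_p=\operatorname{Ann}(P)_p$ for every $p\in M$.
   Context: The $n$-vector $P$ induces the anchor $P^\sharp:\bigwedge^{n-1}T^*M\to TM$ defined by $\beta(P^\sharp(\alpha_1,\ldots,\alpha_{n-1}))=P(\alpha_1,\ldots,\alpha_{n-1},\beta)$ for covectors $\alpha_1,\ldots,\alpha_{n-1},\beta$ at a common point. The cotangent annihilator is $\operatorname{Ann}(P)=\{\alpha\in T^*M: i_\alpha P=0\}$, where $i_\alpha P$ is the contraction $(i_\alpha P)(\beta_2,\ldots,\beta_n)=P(\alpha,\beta_2,\ldots,\beta_n)$, and $\operatorname{Ann}(P)_p=\operatorname{Ann}(P)\cap T_p^*M$. The (pointwise) anchor radical of $\rho=P^\sharp$ at $p$ is $\operatorname{Rad}(\rho)_p=\{\alpha\in T_p^*M: P^\sharp(\alpha,\alpha_2,\ldots,\alpha_{n-1})=0\ \text{for all }\alpha_2,\ldots,\alpha_{n-1}\in T_p^*M\}$. *)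

theory Defs
  imports "HOL-Analysis.Analysis"
begin

section \<open>Smooth maps between open sets\<close>

text \<open>Intended for open \<open>S\<close> and a finite-dimensional domain type, where it is the usual notion
  of a \<open>C\<^sup>k\<close> map (all iterated directional derivatives exist and are continuous).\<close>

primrec C_k_on ::
  "nat \<Rightarrow> 'e::real_normed_vector set \<Rightarrow> ('e \<Rightarrow> 'f::real_normed_vector) \<Rightarrow> bool" where
  "C_k_on 0 S f \<longleftrightarrow> continuous_on S f"
| "C_k_on (Suc k) S f \<longleftrightarrow>
     (\<forall>x\<in>S. f differentiable (at x)) \<and>
     (\<forall>h. C_k_on k S (\<lambda>x. frechet_derivative f (at x) h))"

definition smooth_on ::
  "'e::real_normed_vector set \<Rightarrow> ('e \<Rightarrow> 'f::real_normed_vector) \<Rightarrow> bool" where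
  "smooth_on S f \<longleftrightarrow> (\<forall>k. C_k_on k S f)"


section \<open>Smooth manifolds\<close>

text \<open>A chart is a pair of its domain and its coordinate map; the values of the coordinate map
  outside the domain are irrelevant.\<close>

type_synonym ('a, 'e) chart = "'a set \<times> ('a \<Rightarrow> 'e)"

definition chart_inv :: "('a, 'e) chart \<Rightarrow> 'e \<Rightarrow> 'a" where
  "chart_inv c = the_inv_into (fst c) (snd c)"

definition transition :: "('a, 'e) chart \<Rightarrow> ('a, 'e) chart \<Rightarrow> 'e \<Rightarrow> 'e" where
  "transition c d = snd d \<circ> chart_inv c"

text \<open>The model space is a finite-dimensional normed space rather than a \<open>euclidean_space\<close>, since
  the latter class excludes dimension 0. The atlas need not be maximal.\<close>

definition smooth_manifold ::
  "'a topology \<Rightarrow> ('a, 'e::real_normed_vector) chart set \<Rightarrow> bool" where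
  "smooth_manifold M A \<longleftrightarrow>
     (\<exists>B :: 'e set. finite B \<and> span B = UNIV) \<and>
     Hausdorff_space M \<and> second_countable M \<and>
     (\<Union>c\<in>A. fst c) = topspace M \<and>
     (\<forall>c\<in>A. openin M (fst c) \<and> open (snd c ` fst c) \<and>
        homeomorphic_map (subtopology M (fst c)) (top_of_set (snd c ` fst c)) (snd c)) \<and>
     (\<forall>c\<in>A. \<forall>d\<in>A. smooth_on (snd c ` (fst c \<inter> fst d)) (transition c d))"


section \<open>Tangent and cotangent spaces\<close>

text \<open>A tangent vector at \<open>p\<close> is the family of its coordinate representations in all charts
  around \<open>p\<close>, subject to the transformation law; equivalently, an equivalence class of pairs of
  a chart and a coordinate vector. Charts not containing \<open>p\<close> are sent to 0, so that equality of
  families is equality of tangent vectors.\<close>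

type_synonym ('a, 'e) tvector = "('a, 'e) chart \<Rightarrow> 'e"
type_synonym ('a, 'e) covector = "('a, 'e) tvector \<Rightarrow> real"

definition charts_at :: "('a, 'e) chart set \<Rightarrow> 'a \<Rightarrow> ('a, 'e) chart set" where
  "charts_at A p = {c \<in> A. p \<in> fst c}"

definition tangent_space ::
  "('a, 'e::real_normed_vector) chart set \<Rightarrow> 'a \<Rightarrow> ('a, 'e) tvector set" where
  "tangent_space A p =
     {v. (\<forall>c\<in>charts_at A p. \<forall>d\<in>charts_at A p.
            v d = frechet_derivative (transition c d) (at (snd c p)) (v c)) \<and>
         (\<forall>c. c \<notin> charts_at A p \<longrightarrow> v c = 0)}"

text \<open>Covectors are extended by 0 outside the tangent space, again to make equality the right one.\<close>

definition cotangent_space ::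
  "('a, 'e::real_normed_vector) chart set \<Rightarrow> 'a \<Rightarrow> ('a, 'e) covector set" where
  "cotangent_space A p =
     {\<alpha>. (\<forall>v\<in>tangent_space A p. \<forall>w\<in>tangent_space A p. \<alpha> (\<lambda>c. v c + w c) = \<alpha> v + \<alpha> w) \<and>
         (\<forall>r. \<forall>v\<in>tangent_space A p. \<alpha> (\<lambda>c. r *\<^sub>R v c) = r * \<alpha> v) \<and>
         (\<forall>v. v \<notin> tangent_space A p \<longrightarrow> \<alpha> v = 0)}"

definition cotangent_bundle ::
  "'a topology \<Rightarrow> ('a, 'e::real_normed_vector) chart set \<Rightarrow> ('a \<times> ('a, 'e) covector) set" where
  "cotangent_bundle M A = (SIGMA p:topspace M. cotangent_space A p)"

definition covector_lists ::
  "('a, 'e::real_normed_vector) chart set \<Rightarrow> 'a \<Rightarrow> nat \<Rightarrow> ('a, 'e) covector list set" where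
  "covector_lists A p k = {\<alpha>s. length \<alpha>s = k \<and> set \<alpha>s \<subseteq> cotangent_space A p}"


section \<open>Multivector fields\<close>

text \<open>The exterior power \<open>\<And>\<^sup>n T\<^sub>pM\<close> as the space of alternating multilinear forms of \<open>n\<close> covectors,
  extended by 0 to all other lists.\<close>

type_synonym ('a, 'e) multivector = "('a, 'e) covector list \<Rightarrow> real"

definition multivectors ::
  "('a, 'e::real_normed_vector) chart set \<Rightarrow> nat \<Rightarrow> 'a \<Rightarrow> ('a, 'e) multivector set" where
  "multivectors A n p =
     {Q. (\<forall>\<alpha>s\<in>covector_lists A p n. \<forall>i<n. \<forall>\<beta>\<in>cotangent_space A p. \<forall>\<gamma>\<in>cotangent_space A p.
            Q (\<alpha>s[i := (\<lambda>v. \<beta> v + \<gamma> v)]) = Q (\<alpha>s[i := \<beta>]) + Q (\<alpha>s[i := \<gamma>])) \<and>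
         (\<forall>\<alpha>s\<in>covector_lists A p n. \<forall>i<n. \<forall>r. \<forall>\<beta>\<in>cotangent_space A p.
            Q (\<alpha>s[i := (\<lambda>v. r * \<beta> v)]) = r * Q (\<alpha>s[i := \<beta>])) \<and>
         (\<forall>\<alpha>s\<in>covector_lists A p n. \<not> distinct \<alpha>s \<longrightarrow> Q \<alpha>s = 0) \<and>
         (\<forall>\<alpha>s. \<alpha>s \<notin> covector_lists A p n \<longrightarrow> Q \<alpha>s = 0)}"

text \<open>The covector at \<open>p\<close> with constant coordinate expression \<open>l\<close> in the chart \<open>c\<close>, i.e. the
  pullback of the linear functional \<open>l\<close> under the differential of the coordinate map.\<close>

definition chart_covector ::
  "('a, 'e::real_normed_vector) chart set \<Rightarrow> ('a, 'e) chart \<Rightarrow> 'a \<Rightarrow> ('e \<Rightarrow> real) \<Rightarrow> ('a, 'e) covector"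
  where
  "chart_covector A c p l = (\<lambda>v. if v \<in> tangent_space A p then l (v c) else 0)"

text \<open>A smooth section of \<open>\<And>\<^sup>n TM\<close>: the components in every chart are smooth.\<close>

definition multivector_field ::
  "'a topology \<Rightarrow> ('a, 'e::real_normed_vector) chart set \<Rightarrow> nat \<Rightarrow> ('a \<Rightarrow> ('a, 'e) multivector) \<Rightarrow> bool"
  where
  "multivector_field M A n P \<longleftrightarrow>
     (\<forall>p\<in>topspace M. P p \<in> multivectors A n p) \<and>
     (\<forall>c\<in>A. \<forall>ls. length ls = n \<and> (\<forall>l\<in>set ls. linear l) \<longrightarrow>
        smooth_on (snd c ` fst c)
          (\<lambda>x. P (chart_inv c x) (map (chart_covector A c (chart_inv c x)) ls)))"


section \<open>Anchor, radical and annihilator\<close>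

definition anchor ::
  "('a, 'e::real_normed_vector) chart set \<Rightarrow> ('a \<Rightarrow> ('a, 'e) multivector) \<Rightarrow>
   'a \<Rightarrow> ('a, 'e) covector list \<Rightarrow> ('a, 'e) tvector" where
  "anchor A P p \<alpha>s =
     (THE v. v \<in> tangent_space A p \<and> (\<forall>\<beta>\<in>cotangent_space A p. \<beta> v = P p (\<alpha>s @ [\<beta>])))"

definition anchor_radical ::
  "('a, 'e::real_normed_vector) chart set \<Rightarrow> nat \<Rightarrow>
   ('a \<Rightarrow> ('a, 'e) covector list \<Rightarrow> ('a, 'e) tvector) \<Rightarrow> 'a \<Rightarrow> ('a, 'e) covector set" where
  "anchor_radical A n \<rho> p =
     {\<alpha> \<in> cotangent_space A p. \<forall>\<alpha>s\<in>covector_lists A p (n - 2). \<rho> p (\<alpha> # \<alpha>s) = (\<lambda>c. 0)}"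

definition contraction :: "('a, 'e) covector \<Rightarrow> ('a, 'e) multivector \<Rightarrow> ('a, 'e) multivector" where
  "contraction \<alpha> Q = (\<lambda>\<beta>s. Q (\<alpha> # \<beta>s))"

definition annihilator ::
  "'a topology \<Rightarrow> ('a, 'e::real_normed_vector) chart set \<Rightarrow> ('a \<Rightarrow> ('a, 'e) multivector) \<Rightarrow>
   ('a \<times> ('a, 'e) covector) set" where
  "annihilator M A P = {(p, \<alpha>) \<in> cotangent_bundle M A. contraction \<alpha> (P p) = (\<lambda>\<beta>s. 0)}"

definition annihilator_at ::
  "'a topology \<Rightarrow> ('a, 'e::real_normed_vector) chart set \<Rightarrow> ('a \<Rightarrow> ('a, 'e) multivector) \<Rightarrow>
   'a \<Rightarrow> ('a, 'e) covector set" where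
  "annihilator_at M A P p = {\<alpha>. (p, \<alpha>) \<in> annihilator M A P}"

end

(* At each point the cotangent space is the full dual of the finite-dimensional tangent space, so
   a linear functional on covectors is evaluation at a unique tangent vector. Hence the vector
   P#(alpha, alpha_2, ..., alpha_(n-1)) is well defined, and it vanishes iff
   P(alpha, alpha_2, ..., alpha_(n-1), beta) = 0 for all covectors beta. *)
theory Submission
  imports Defs
begin

section \<open>The tangent space\<close>

lemma transition_differentiable:
  assumes "smooth_manifold M A" "c \<in> charts_at A p" "d \<in> charts_at A p"
  shows "transition c d differentiable at (snd c p)"
proof -
  \<comment> \<open>Level 0 of \<open>C_k_on\<close> gives only continuity; level 1 is the first
    that asserts differentiability.\<close>
  have "C_k_on (Suc 0) (snd c ` (fst c \<inter> fst d)) (transition c d)"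
    using assms unfolding smooth_manifold_def smooth_on_def charts_at_def by blast
  moreover have "snd c p \<in> snd c ` (fst c \<inter> fst d)"
    using assms unfolding charts_at_def by blast
  ultimately show ?thesis unfolding C_k_on.simps by blast
qed

text \<open>\<open>frechet_derivative\<close> is a choice operator, so linearity has to come from
  existence of the derivative. It makes the transformation law compatible with sums and
  multiples.\<close>

lemma linear_transition_derivative:
  assumes "smooth_manifold M A" "c \<in> charts_at A p" "d \<in> charts_at A p"
  shows "linear (frechet_derivative (transition c d) (at (snd c p)))"
  using transition_differentiable[OF assms] by (rule linear_frechet_derivative)

lemma tangent_spaceI:
  assumes "\<And>c d. c \<in> charts_at A p \<Longrightarrow> d \<in> charts_at A p \<Longrightarrow>
      frechet_derivative (transition c d) (at (snd c p)) (v c) = v d"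
    and "\<And>c. c \<notin> charts_at A p \<Longrightarrow> v c = 0"
  shows "v \<in> tangent_space A p"
  unfolding tangent_space_def by (intro CollectI conjI ballI allI impI assms(1)[symmetric] assms(2))

text \<open>Oriented from derivative to coordinate for rewriting; the other orientation would leave
  the source chart \<open>c\<close> undetermined.\<close>

lemma tangent_space_transition:
  assumes "v \<in> tangent_space A p" "c \<in> charts_at A p" "d \<in> charts_at A p"
  shows "frechet_derivative (transition c d) (at (snd c p)) (v c) = v d"
  using CollectD[OF assms(1)[unfolded tangent_space_def], THEN conjunct1, rule_format, OF assms(2,3)]
  by (rule sym)

lemma tangent_space_outside:
  assumes "v \<in> tangent_space A p" "c \<notin> charts_at A p"
  shows "v c = 0"
  using assms unfolding tangent_space_def by blast

lemma tangent_space_zero: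
  assumes "smooth_manifold M A"
  shows "(\<lambda>c. 0) \<in> tangent_space A p"
  by (intro tangent_spaceI) (simp_all add: linear_0[OF linear_transition_derivative[OF assms]])

lemma tangent_space_add:
  assumes "smooth_manifold M A" "v \<in> tangent_space A p" "w \<in> tangent_space A p"
  shows "(\<lambda>c. v c + w c) \<in> tangent_space A p"
  using assms(2,3)
  by (intro tangent_spaceI)
    (simp_all add: linear_add[OF linear_transition_derivative[OF assms(1)]]
      tangent_space_transition tangent_space_outside)

lemma tangent_space_scale:
  assumes "smooth_manifold M A" "v \<in> tangent_space A p"
  shows "(\<lambda>c. r *\<^sub>R v c) \<in> tangent_space A p"
  using assms(2)
  by (intro tangent_spaceI)
    (simp_all add: linear_cmul[OF linear_transition_derivative[OF assms(1)]]
      tangent_space_transition tangent_space_outside)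

lemma tangent_space_sum:
  assumes "smooth_manifold M A" "\<And>i. i \<in> I \<Longrightarrow> v i \<in> tangent_space A p"
  shows "(\<lambda>c. \<Sum>i\<in>I. r i *\<^sub>R v i c) \<in> tangent_space A p"
  using assms(2)
proof (induction I rule: infinite_finite_induct)
  case (insert i I)
  then show ?case
    using tangent_space_add[OF assms(1) tangent_space_scale[OF assms(1), of "v i" p "r i"]]
    by simp
\<comment> \<open>A sum over an infinite set is 0 by convention, so the infinite and the empty case
  both give the zero vector.\<close>
qed (simp_all add: tangent_space_zero[OF assms(1)])

text \<open>The transformation law determines every coordinate at \<open>p\<close> from the one in
  \<open>c\<close>, and all other entries are 0.\<close>

lemma tangent_space_eqI:
  assumes "c \<in> charts_at A p" "v \<in> tangent_space A p" "w \<in> tangent_space A p" "v c = w c"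
  shows "v = w"
proof
  fix d
  show "v d = w d"
    using assms by (metis tangent_space_transition tangent_space_outside)
qed

text \<open>Bases are taken in the model space: for a chart \<open>c\<close> around \<open>p\<close>
  the coordinate is injective by \<open>tangent_space_eqI\<close>, and its image, being a subspace,
  is the span of a basis.\<close>

lemma subspace_tangent_coordinates:
  assumes "smooth_manifold M A"
  shows "subspace ((\<lambda>v. v c) ` tangent_space A p)"
proof (rule subspaceI)
  show "0 \<in> (\<lambda>v. v c) ` tangent_space A p"
    using imageI[OF tangent_space_zero[OF assms], of "\<lambda>v. v c"] by simp
next
  fix x y assume "x \<in> (\<lambda>v. v c) ` tangent_space A p" "y \<in> (\<lambda>v. v c) ` tangent_space A p"
  then show "x + y \<in> (\<lambda>v. v c) ` tangent_space A p"
    using imageI[OF tangent_space_add[OF assms], of _ p _ "\<lambda>v. v c"] by auto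
next
  fix r x assume "x \<in> (\<lambda>v. v c) ` tangent_space A p"
  then show "r *\<^sub>R x \<in> (\<lambda>v. v c) ` tangent_space A p"
    using imageI[OF tangent_space_scale[OF assms], of _ p "\<lambda>v. v c"] by auto
qed

section \<open>The cotangent space\<close>

lemma cotangent_space_zero: "(\<lambda>v. 0) \<in> cotangent_space A p"
  unfolding cotangent_space_def by simp

lemma cotangent_space_add:
  assumes "\<alpha> \<in> cotangent_space A p" "\<beta> \<in> cotangent_space A p"
  shows "(\<lambda>v. \<alpha> v + \<beta> v) \<in> cotangent_space A p"
  using assms unfolding cotangent_space_def by (simp add: algebra_simps)

lemma cotangent_space_scale:
  assumes "\<alpha> \<in> cotangent_space A p"
  shows "(\<lambda>v. r * \<alpha> v) \<in> cotangent_space A p"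
  using assms unfolding cotangent_space_def by (simp add: algebra_simps)

lemma cotangent_space_sum:
  assumes "\<And>i. i \<in> I \<Longrightarrow> \<alpha> i \<in> cotangent_space A p"
  shows "(\<lambda>v. \<Sum>i\<in>I. r i * \<alpha> i v) \<in> cotangent_space A p"
  using assms
proof (induction I rule: infinite_finite_induct)
  case (insert i I)
  then show ?case
    using cotangent_space_add[OF cotangent_space_scale[of "\<alpha> i" A p "r i"]] by simp
qed (simp_all add: cotangent_space_zero)

lemma covector_zero:
  assumes "smooth_manifold M A" "\<alpha> \<in> cotangent_space A p"
  shows "\<alpha> (\<lambda>c. 0) = 0"
proof -
  have "\<forall>r. \<forall>v\<in>tangent_space A p. \<alpha> (\<lambda>c. r *\<^sub>R v c) = r * \<alpha> v"
    using assms(2) unfolding cotangent_space_def by blast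
  \<comment> \<open>Homogeneity with factor 0, applied to the zero vector itself.\<close>
  from bspec[OF spec[OF this, of 0] tangent_space_zero[OF assms(1)]] show ?thesis by simp
qed

lemma covector_sum:
  assumes "smooth_manifold M A" "\<alpha> \<in> cotangent_space A p"
    and "\<And>i. i \<in> I \<Longrightarrow> v i \<in> tangent_space A p"
  shows "\<alpha> (\<lambda>c. \<Sum>i\<in>I. r i *\<^sub>R v i c) = (\<Sum>i\<in>I. r i * \<alpha> (v i))"
  using assms(3)
proof (induction I rule: infinite_finite_induct)
  case (insert i I)
  \<comment> \<open>Covectors are additive only on the tangent space, so both summands must be shown
    to lie in it.\<close>
  have "(\<lambda>c. r i *\<^sub>R v i c) \<in> tangent_space A p"
    and "(\<lambda>c. \<Sum>j\<in>I. r j *\<^sub>R v j c) \<in> tangent_space A p"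
    using insert.prems by (auto intro!: tangent_space_scale tangent_space_sum assms(1))
  then show ?case
    using insert assms(2) unfolding cotangent_space_def by simp
qed (simp_all add: covector_zero[OF assms(1,2)])

text \<open>Dual counterpart of \<open>covector_sum\<close>. Later \<open>F\<close> is the
  evaluation of a multivector in its last slot, whose linearity is known on the cotangent space
  only.\<close>

lemma cotangent_functional_sum:
  assumes add: "\<And>\<beta> \<gamma>. \<beta> \<in> cotangent_space A p \<Longrightarrow> \<gamma> \<in> cotangent_space A p \<Longrightarrow>
      F (\<lambda>v. \<beta> v + \<gamma> v) = F \<beta> + F \<gamma>"
    and scale: "\<And>r \<beta>. \<beta> \<in> cotangent_space A p \<Longrightarrow> F (\<lambda>v. r * \<beta> v) = r * F \<beta>"
    and "\<And>i. i \<in> I \<Longrightarrow> \<alpha> i \<in> cotangent_space A p"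
  shows "F (\<lambda>v. \<Sum>i\<in>I. r i * \<alpha> i v) = (\<Sum>i\<in>I. r i * F (\<alpha> i))"
proof -
  have zero: "F (\<lambda>v. 0) = 0"
    using scale[OF cotangent_space_zero, of 0] by simp
  show ?thesis
    using assms(3)
  proof (induction I rule: infinite_finite_induct)
    case (insert i I)
    then show ?case
      using add[OF cotangent_space_scale cotangent_space_sum, of "\<alpha> i" I \<alpha> "r i" r]
      by (simp add: scale)
  qed (simp_all add: zero)
qed

text \<open>A basis \<open>B\<close> of the coordinate image in \<open>c\<close> is the index set:
  \<open>u b\<close> is the tangent vector with coordinate \<open>b\<close>, and
  \<open>\<delta> b\<close> reads off the coefficient of \<open>b\<close>.\<close>

lemma dual_bases:
  fixes A :: "('a, 'e::real_normed_vector) chart set"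
  assumes M: "smooth_manifold M A" and c: "c \<in> charts_at A p"
  shows "\<exists>(B :: 'e set) u \<delta>. u ` B \<subseteq> tangent_space A p \<and> \<delta> ` B \<subseteq> cotangent_space A p \<and>
    (\<forall>v\<in>tangent_space A p. (\<lambda>d. \<Sum>b\<in>B. \<delta> b v *\<^sub>R u b d) = v)"
proof -
  let ?W = "(\<lambda>v. v c) ` tangent_space A p"
  have W: "subspace ?W" using subspace_tangent_coordinates[OF M] .
  obtain B where B: "B \<subseteq> ?W" "independent B" "?W \<subseteq> span B"
    using basis_exists by metis
  have spanB: "span B = ?W"
    using B W span_minimal by blast
  \<comment> \<open>Finite dimension enters here: with \<open>B\<close> finite, the expansion may
    run over all of \<open>B\<close>.\<close>
  obtain G :: "'e set" where "finite G" "span G = UNIV"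
    using M unfolding smooth_manifold_def by blast
  then have fin: "finite B"
    using independent_span_bound[OF _ B(2), of G] by auto
  have "\<forall>b\<in>B. \<exists>v. v \<in> tangent_space A p \<and> v c = b"
    using B(1) by auto
  then obtain u where u: "\<And>b. b \<in> B \<Longrightarrow> u b \<in> tangent_space A p" "\<And>b. b \<in> B \<Longrightarrow> u b c = b"
    by metis
  \<comment> \<open>The value 0 off the tangent space is part of membership in
    \<open>cotangent_space\<close>.\<close>
  define \<delta> where "\<delta> b v = (if v \<in> tangent_space A p then representation B (v c) b else 0)"
    for b :: 'e and v :: "('a, 'e) tvector"
  have "\<delta> b \<in> cotangent_space A p" for b
    unfolding cotangent_space_def \<delta>_def
    using spanB
    by (auto simp: tangent_space_add[OF M] tangent_space_scale[OF M]
        representation_add[OF B(2)] representation_scale[OF B(2)])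
  moreover have "(\<lambda>d. \<Sum>b\<in>B. \<delta> b v *\<^sub>R u b d) = v" if v: "v \<in> tangent_space A p" for v
  proof (rule tangent_space_eqI[OF c _ v])
    show "(\<lambda>d. \<Sum>b\<in>B. \<delta> b v *\<^sub>R u b d) \<in> tangent_space A p"
      by (rule tangent_space_sum[OF M u(1)])
    have "(\<Sum>b\<in>B. \<delta> b v *\<^sub>R u b c) = (\<Sum>b\<in>B. representation B (v c) b *\<^sub>R b)"
      using u(2) v by (intro sum.cong) (auto simp: \<delta>_def)
    also have "\<dots> = v c"
      using sum_representation_eq[OF B(2) _ fin order_refl, of "v c"] spanB v by auto
    finally show "(\<Sum>b\<in>B. \<delta> b v *\<^sub>R u b c) = v c" .
  qed
  ultimately show ?thesis using u(1) by (intro exI[of _ B] exI[of _ u] exI[of _ \<delta>]) blast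
qed

lemma charts_at_nonempty:
  assumes "smooth_manifold M A" "p \<in> topspace M"
  obtains c where "c \<in> charts_at A p"
  using assms unfolding smooth_manifold_def charts_at_def by blast

text \<open>Reflexivity in finite dimension: the coefficient along \<open>u b\<close> has to be
  \<open>F (\<delta> b)\<close>.\<close>

lemma cotangent_functional_ex1:
  fixes A :: "('a, 'e::real_normed_vector) chart set"
  assumes M: "smooth_manifold M A" and p: "p \<in> topspace M"
    and add: "\<And>\<beta> \<gamma>. \<beta> \<in> cotangent_space A p \<Longrightarrow> \<gamma> \<in> cotangent_space A p \<Longrightarrow>
      F (\<lambda>v. \<beta> v + \<gamma> v) = F \<beta> + F \<gamma>"
    and scale: "\<And>r \<beta>. \<beta> \<in> cotangent_space A p \<Longrightarrow> F (\<lambda>v. r * \<beta> v) = r * F \<beta>"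
  shows "\<exists>!v. v \<in> tangent_space A p \<and> (\<forall>\<beta>\<in>cotangent_space A p. \<beta> v = F \<beta>)"
proof -
  obtain c where c: "c \<in> charts_at A p"
    using charts_at_nonempty[OF M p] .
  obtain B :: "'e set" and u \<delta> where
    bases: "u ` B \<subseteq> tangent_space A p" "\<delta> ` B \<subseteq> cotangent_space A p" and
    expand: "\<forall>v\<in>tangent_space A p. (\<lambda>d. \<Sum>b\<in>B. \<delta> b v *\<^sub>R u b d) = v"
    using dual_bases[OF M c] by blast
  have u: "\<And>b. b \<in> B \<Longrightarrow> u b \<in> tangent_space A p"
    and \<delta>: "\<And>b. b \<in> B \<Longrightarrow> \<delta> b \<in> cotangent_space A p"
    using bases by auto
  show ?thesis
  proof (rule ex1I)
    let ?v = "\<lambda>d. \<Sum>b\<in>B. F (\<delta> b) *\<^sub>R u b d"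
    have "\<beta> ?v = F \<beta>" if \<beta>: "\<beta> \<in> cotangent_space A p" for \<beta>
    proof -
      \<comment> \<open>Expansion of \<beta> in the dual basis. It is proved for every
        \<open>v\<close>, even off the tangent space, because \<open>F\<close> takes functions and
        needs equality of functions.\<close>
      have "\<beta> v = (\<Sum>b\<in>B. \<beta> (u b) * \<delta> b v)" for v
      proof (cases "v \<in> tangent_space A p")
        case True
        then have "\<beta> v = \<beta> (\<lambda>d. \<Sum>b\<in>B. \<delta> b v *\<^sub>R u b d)"
          using expand by simp
        also have "\<dots> = (\<Sum>b\<in>B. \<delta> b v * \<beta> (u b))"
          by (rule covector_sum[OF M \<beta> u])
        finally show ?thesis by (simp add: mult.commute)
      next
        case False
        then show ?thesis using \<beta> \<delta> unfolding cotangent_space_def by simp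
      qed
      then have "F \<beta> = F (\<lambda>v. \<Sum>b\<in>B. \<beta> (u b) * \<delta> b v)"
        by (intro arg_cong[of _ _ F] ext)
      also have "\<dots> = (\<Sum>b\<in>B. \<beta> (u b) * F (\<delta> b))"
        by (rule cotangent_functional_sum[OF add scale \<delta>])
      also have "\<dots> = \<beta> ?v"
        by (simp add: covector_sum[OF M \<beta> u] mult.commute)
      finally show ?thesis by simp
    qed
    then show "?v \<in> tangent_space A p \<and> (\<forall>\<beta>\<in>cotangent_space A p. \<beta> ?v = F \<beta>)"
      using tangent_space_sum[OF M u] by simp
  next
    fix w assume w: "w \<in> tangent_space A p \<and> (\<forall>\<beta>\<in>cotangent_space A p. \<beta> w = F \<beta>)"
    then have "w = (\<lambda>d. \<Sum>b\<in>B. \<delta> b w *\<^sub>R u b d)"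
      using expand by simp
    \<comment> \<open>Each \<open>\<delta> b\<close> is itself a covector, so the condition on
      \<open>w\<close> fixes its coefficients.\<close>
    also have "\<dots> = (\<lambda>d. \<Sum>b\<in>B. F (\<delta> b) *\<^sub>R u b d)"
      using w \<delta> by simp
    finally show "w = (\<lambda>d. \<Sum>b\<in>B. F (\<delta> b) *\<^sub>R u b d)" .
  qed
qed

section \<open>The anchor\<close>

lemma covector_lists_append1:
  assumes "\<alpha>s \<in> covector_lists A p k" "\<beta> \<in> cotangent_space A p"
  shows "\<alpha>s @ [\<beta>] \<in> covector_lists A p (Suc k)"
  using assms unfolding covector_lists_def by auto

lemma multivector_last_add:
  assumes "Q \<in> multivectors A (Suc k) p" "\<alpha>s \<in> covector_lists A p k"
    and "\<beta> \<in> cotangent_space A p" "\<gamma> \<in> cotangent_space A p"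
  shows "Q (\<alpha>s @ [\<lambda>v. \<beta> v + \<gamma> v]) = Q (\<alpha>s @ [\<beta>]) + Q (\<alpha>s @ [\<gamma>])"
proof -
  let ?l = "\<alpha>s @ [\<beta>]"
  \<comment> \<open>Multilinearity is stated through list updates; as \<alpha>s has length
    \<open>k\<close>, index \<open>k\<close> is the appended entry.\<close>
  have "Q (?l[k := \<lambda>v. \<beta> v + \<gamma> v]) = Q (?l[k := \<beta>]) + Q (?l[k := \<gamma>])"
    using assms covector_lists_append1[OF assms(2,3)] unfolding multivectors_def by blast
  moreover have "length \<alpha>s = k" using assms(2) unfolding covector_lists_def by simp
  ultimately show ?thesis by (auto simp: list_update_append)
qed

lemma multivector_last_scale:
  assumes "Q \<in> multivectors A (Suc k) p" "\<alpha>s \<in> covector_lists A p k"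
    and "\<beta> \<in> cotangent_space A p"
  shows "Q (\<alpha>s @ [\<lambda>v. r * \<beta> v]) = r * Q (\<alpha>s @ [\<beta>])"
proof -
  let ?l = "\<alpha>s @ [\<beta>]"
  have "Q (?l[k := \<lambda>v. r * \<beta> v]) = r * Q (?l[k := \<beta>])"
    using assms covector_lists_append1[OF assms(2,3)] unfolding multivectors_def by blast
  moreover have "length \<alpha>s = k" using assms(2) unfolding covector_lists_def by simp
  ultimately show ?thesis by (auto simp: list_update_append)
qed

text \<open>Justifies the definite description in \<open>anchor\<close>: an (n-1)-tuple of covectors
  leaves one linear slot of the n-vector free.\<close>

lemma anchor_ex1:
  assumes "smooth_manifold M A" "p \<in> topspace M"
    and "P p \<in> multivectors A (Suc k) p" "\<alpha>s \<in> covector_lists A p k"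
  shows "\<exists>!v. v \<in> tangent_space A p \<and> (\<forall>\<beta>\<in>cotangent_space A p. \<beta> v = P p (\<alpha>s @ [\<beta>]))"
  using assms
  by (intro cotangent_functional_ex1 multivector_last_add multivector_last_scale)

text \<open>Forwards, covectors vanish at the zero vector; backwards, the zero vector satisfies the
  description of the anchor, so uniqueness applies.\<close>

lemma anchor_eq_zero_iff:
  assumes "smooth_manifold M A" "p \<in> topspace M"
    and "P p \<in> multivectors A (Suc k) p" "\<alpha>s \<in> covector_lists A p k"
  shows "anchor A P p \<alpha>s = (\<lambda>c. 0) \<longleftrightarrow> (\<forall>\<beta>\<in>cotangent_space A p. P p (\<alpha>s @ [\<beta>]) = 0)"
proof
  assume "anchor A P p \<alpha>s = (\<lambda>c. 0)"
  then show "\<forall>\<beta>\<in>cotangent_space A p. P p (\<alpha>s @ [\<beta>]) = 0"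
    using theI'[OF anchor_ex1[of M A p P, OF assms]] covector_zero[OF assms(1)]
    unfolding anchor_def by force
next
  assume "\<forall>\<beta>\<in>cotangent_space A p. P p (\<alpha>s @ [\<beta>]) = 0"
  then have "(\<lambda>c. 0) \<in> tangent_space A p \<and>
      (\<forall>\<beta>\<in>cotangent_space A p. \<beta> (\<lambda>c. 0) = P p (\<alpha>s @ [\<beta>]))"
    using tangent_space_zero[OF assms(1)] covector_zero[OF assms(1)] by auto
  then show "anchor A P p \<alpha>s = (\<lambda>c. 0)"
    unfolding anchor_def by (rule the1_equality[OF anchor_ex1[of M A p P, OF assms]])
qed

text \<open>The contraction must vanish on all lists, the right side speaks only of covector lists
  split at the last entry. The extension of \<open>Q\<close> by 0 closes this gap.\<close>

lemma contraction_eq_zero_iff: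
  assumes "Q \<in> multivectors A (Suc (Suc k)) p" "\<alpha> \<in> cotangent_space A p"
  shows "contraction \<alpha> Q = (\<lambda>\<beta>s. 0) \<longleftrightarrow>
    (\<forall>\<alpha>s\<in>covector_lists A p k. \<forall>\<beta>\<in>cotangent_space A p. Q (\<alpha> # \<alpha>s @ [\<beta>]) = 0)"
proof
  assume "contraction \<alpha> Q = (\<lambda>\<beta>s. 0)"
  then show "\<forall>\<alpha>s\<in>covector_lists A p k. \<forall>\<beta>\<in>cotangent_space A p. Q (\<alpha> # \<alpha>s @ [\<beta>]) = 0"
    unfolding contraction_def by meson
next
  assume vanish: "\<forall>\<alpha>s\<in>covector_lists A p k. \<forall>\<beta>\<in>cotangent_space A p. Q (\<alpha> # \<alpha>s @ [\<beta>]) = 0"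
  have "Q (\<alpha> # \<beta>s) = 0" for \<beta>s
  proof (cases "\<alpha> # \<beta>s \<in> covector_lists A p (Suc (Suc k))")
    case True
    \<comment> \<open>Here \<beta>s has length \<open>Suc k\<close>, hence is nonempty and has a
      last entry.\<close>
    then obtain \<alpha>s \<beta> where "\<beta>s = \<alpha>s @ [\<beta>]"
      unfolding covector_lists_def by (cases \<beta>s rule: rev_cases) auto
    with True vanish show ?thesis unfolding covector_lists_def by auto
  next
    case False
    then show ?thesis using assms(1) unfolding multivectors_def by blast
  qed
  then show "contraction \<alpha> Q = (\<lambda>\<beta>s. 0)" unfolding contraction_def by auto
qed

theorem proposition5p1:
  fixes M :: "'a topology"
    and A :: "('a, 'e::real_normed_vector) chart set"
    and P :: "'a \<Rightarrow> ('a, 'e) multivector"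
    and n :: nat
  assumes "smooth_manifold M A"
    and "n \<ge> 2"
    and "multivector_field M A n P"
  shows "\<forall>p\<in>topspace M. anchor_radical A n (anchor A P) p = annihilator_at M A P p"
proof
  fix p assume p: "p \<in> topspace M"
  \<comment> \<open>\<open>k\<close> = n-2 counts the free arguments of the radical; with \<alpha>
    in front, the anchor receives \<open>Suc k\<close> = n-1 covectors.\<close>
  obtain k where n: "n = Suc (Suc k)"
    using assms(2) by (metis add_2_eq_Suc le_Suc_ex)
  have P: "P p \<in> multivectors A (Suc (Suc k)) p"
    using assms(3) p n unfolding multivector_field_def by blast
  have "(\<forall>\<alpha>s\<in>covector_lists A p k. anchor A P p (\<alpha> # \<alpha>s) = (\<lambda>c. 0)) \<longleftrightarrow>
      contraction \<alpha> (P p) = (\<lambda>\<beta>s. 0)" if \<alpha>: "\<alpha> \<in> cotangent_space A p" for \<alpha>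
  proof -
    have "\<alpha> # \<alpha>s \<in> covector_lists A p (Suc k)" if "\<alpha>s \<in> covector_lists A p k" for \<alpha>s
      using \<alpha> that unfolding covector_lists_def by simp
    then show ?thesis
      by (simp add: anchor_eq_zero_iff[of M A p P, OF assms(1) p P] contraction_eq_zero_iff[OF P \<alpha>])
  qed
  \<comment> \<open>Over a point of the manifold, membership in the cotangent bundle is membership
    in the cotangent space there.\<close>
  then show "anchor_radical A n (anchor A P) p = annihilator_at M A P p"
    using p unfolding anchor_radical_def annihilator_at_def annihilator_def cotangent_bundle_def n
    by auto
qed

end
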